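(* Let $(P;\oplus,0,1)$ be a lattice pseudo-effect algebra, regarded as a pseudo Sasaki algebra with the operations $x\circ y:=(x\wedge y^-)/ x$ and $x\ast y:=x\backslash(x\wedge y^{\sim})$. If $a\ast b=b\circ a$ for all $a,b\in P$, then $P$ is a pseudo MV-algebra.
   Context: A pseudo-effect algebra (PEA) is a partial algebra $(P;\oplus,0,1)$, with $\oplus$ a partial binary operation and $0,1$ constants, such that for all $a,b,c\in P$: (PE1) $a\oplus b$ and $(a\oplus b)\oplus c$ exist iff $b\oplus c$ and $a\oplus(b\oplus c)$ exist, and in this case $(a\oplus b)\oplus c=a\oplus(b\oplus c)$; (PE2) there exist exactly one $d\in P$ and exactly one $e\in P$ with $a\oplus d=e\oplus a=1$; (PE3) if $a\oplus b$ exists, there are $d,e\in P$ with $a\oplus b=d\oplus a=b\oplus e$; (PE4) if $a\oplus 1$ or $1\oplus a$ exists, then $a=0$. The partial order is: $a\le b$ iff $c\oplus a=b$ for some $c\in P$, equivalently iff $a\oplus d=b$ for some $d\in P$. For $a\le b$, $b\backslash a$ is the element $x$ with $b=x\oplus a$, and $a/ b$ is the element $y$ with $b=a\oplus y$ (these are unique). Complements: $a^-:=1\backslash a$ and $a^{\sim}:=a/ 1$, so $a^-\oplus a=1=a\oplus a^{\sim}$. A lattice pseudo-effect algebra (LPEA) is a PEA that is a lattice under this order. Elements $a,b$ of an LPEA are compatible iff $(a\vee b)\backslash a=b\backslash(a\wedge b)$ and $(a\vee b)\backslash b=a\backslash(a\wedge b)$. Here a pseudo MV-algebra is understood (via a known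 theorem of Dvurečenskij and Vetterlein) as a lattice pseudo-effect algebra in which all pairs of elements are compatible. *)

theory Defs
  imports Main
begin

text \<open>
  The carrier is the whole type \<open>'a\<close>. The partial operation takes values in \<open>'a option\<close>:
  \<open>a \<oplus> b = Some c\<close> means that \<open>a \<oplus> b\<close> exists and equals \<open>c\<close>, and \<open>a \<oplus> b = None\<close> that it
  does not exist.
\<close>

locale pseudo_effect_algebra =
  fixes oplus :: "'a \<Rightarrow> 'a \<Rightarrow> 'a option" (infixl "\<oplus>" 65)
    and zero :: 'a ("\<zero>")
    and one :: 'a ("\<one>")
  assumes PE1_ex: "(\<exists>x. a \<oplus> b = Some x \<and> x \<oplus> c \<noteq> None) \<longleftrightarrow> (\<exists>y. b \<oplus> c = Some y \<and> a \<oplus> y \<noteq> None)"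
    and PE1_eq: "a \<oplus> b = Some x \<Longrightarrow> x \<oplus> c = Some u \<Longrightarrow> b \<oplus> c = Some y \<Longrightarrow> a \<oplus> y = Some v \<Longrightarrow> u = v"
    and PE2: "(\<exists>!d. a \<oplus> d = Some \<one>) \<and> (\<exists>!e. e \<oplus> a = Some \<one>)"
    and PE3: "a \<oplus> b = Some c \<Longrightarrow> \<exists>d e. d \<oplus> a = Some c \<and> b \<oplus> e = Some c"
    and PE4: "a \<oplus> \<one> \<noteq> None \<or> \<one> \<oplus> a \<noteq> None \<Longrightarrow> a = \<zero>"
begin

definition le :: "'a \<Rightarrow> 'a \<Rightarrow> bool" (infix "\<sqsubseteq>" 50)
  where "a \<sqsubseteq> b \<longleftrightarrow> (\<exists>c. c \<oplus> a = Some b)"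

definition less :: "'a \<Rightarrow> 'a \<Rightarrow> bool" (infix "\<sqsubset>" 50)
  where "a \<sqsubset> b \<longleftrightarrow> a \<sqsubseteq> b \<and> \<not> b \<sqsubseteq> a"

text \<open>
  \<open>rdiff b a\<close> is \<open>b \ a\<close> and \<open>ldiff a b\<close> is \<open>a / b\<close>. Both are meaningful only for
  \<open>a \<sqsubseteq> b\<close>; see \<open>rdiff_oplus\<close> and \<open>oplus_ldiff\<close> below.
\<close>

definition rdiff :: "'a \<Rightarrow> 'a \<Rightarrow> 'a"
  where "rdiff b a = (THE x. x \<oplus> a = Some b)"

definition ldiff :: "'a \<Rightarrow> 'a \<Rightarrow> 'a"
  where "ldiff a b = (THE y. a \<oplus> y = Some b)"

text \<open>\<open>lcompl a\<close> is \<open>a\<close> with superscript minus, \<open>rcompl a\<close> is \<open>a\<close> with superscript tilde.\<close>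

definition lcompl :: "'a \<Rightarrow> 'a"
  where "lcompl a = rdiff \<one> a"

definition rcompl :: "'a \<Rightarrow> 'a"
  where "rcompl a = ldiff a \<one>"

definition is_meet :: "'a \<Rightarrow> 'a \<Rightarrow> 'a \<Rightarrow> bool"
  where "is_meet a b m \<longleftrightarrow> m \<sqsubseteq> a \<and> m \<sqsubseteq> b \<and> (\<forall>z. z \<sqsubseteq> a \<and> z \<sqsubseteq> b \<longrightarrow> z \<sqsubseteq> m)"

definition is_join :: "'a \<Rightarrow> 'a \<Rightarrow> 'a \<Rightarrow> bool"
  where "is_join a b j \<longleftrightarrow> a \<sqsubseteq> j \<and> b \<sqsubseteq> j \<and> (\<forall>z. a \<sqsubseteq> z \<and> b \<sqsubseteq> z \<longrightarrow> j \<sqsubseteq> z)"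

definition meet :: "'a \<Rightarrow> 'a \<Rightarrow> 'a" (infixl "\<sqinter>" 70)
  where "a \<sqinter> b = (THE m. is_meet a b m)"

definition join :: "'a \<Rightarrow> 'a \<Rightarrow> 'a" (infixl "\<squnion>" 65)
  where "a \<squnion> b = (THE j. is_join a b j)"

lemma assoc_left:
  assumes "a \<oplus> b = Some x" "x \<oplus> c = Some u"
  obtains y where "b \<oplus> c = Some y" "a \<oplus> y = Some u"
  using assms PE1_ex[of a b c] PE1_eq[of a b x c u] by fastforce

lemma assoc_right:
  assumes "b \<oplus> c = Some y" "a \<oplus> y = Some u"
  obtains x where "a \<oplus> b = Some x" "x \<oplus> c = Some u"
  using assms PE1_ex[of a b c] PE1_eq[of a b _ c _ y u] by fastforce

lemma one_right_unique: "a \<oplus> d = Some \<one> \<Longrightarrow> a \<oplus> e = Some \<one> \<Longrightarrow> d = e"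
  using PE2 by blast

lemma one_left_unique: "d \<oplus> a = Some \<one> \<Longrightarrow> e \<oplus> a = Some \<one> \<Longrightarrow> d = e"
  using PE2 by blast

lemma left_cancel:
  assumes "a \<oplus> b = Some s" "a \<oplus> c = Some s"
  shows "b = c"
proof -
  obtain t where t: "s \<oplus> t = Some \<one>" using PE2 by blast
  obtain y where y: "b \<oplus> t = Some y" "a \<oplus> y = Some \<one>"
    using assoc_left[OF assms(1) t] by blast
  obtain z where z: "c \<oplus> t = Some z" "a \<oplus> z = Some \<one>"
    using assoc_left[OF assms(2) t] by blast
  have "y = z" using y z one_right_unique by blast
  obtain w where w: "y \<oplus> w = Some \<one>" using PE2 by blast
  obtain p where p: "t \<oplus> w = Some p" "b \<oplus> p = Some \<one>"
    using assoc_left[OF y(1) w] by blast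
  obtain q where q: "t \<oplus> w = Some q" "c \<oplus> q = Some \<one>"
    using assoc_left[OF z(1) w[unfolded \<open>y = z\<close>]] by blast
  show ?thesis using p q one_left_unique by auto
qed

lemma right_cancel:
  assumes "b \<oplus> a = Some s" "c \<oplus> a = Some s"
  shows "b = c"
proof -
  obtain t where t: "t \<oplus> s = Some \<one>" using PE2 by blast
  obtain y where y: "t \<oplus> b = Some y" "y \<oplus> a = Some \<one>"
    using assoc_right[OF assms(1) t] by blast
  obtain z where z: "t \<oplus> c = Some z" "z \<oplus> a = Some \<one>"
    using assoc_right[OF assms(2) t] by blast
  have "y = z" using y z one_left_unique by blast
  then show ?thesis using y z left_cancel by blast
qed

lemma zero_oplus: "\<zero> \<oplus> a = Some a"
proof -
  obtain e where "e \<oplus> \<one> = Some \<one>" using PE2 by blast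
  then have e: "\<zero> \<oplus> \<one> = Some \<one>" using PE4 by (metis option.distinct(1))
  obtain d where d: "a \<oplus> d = Some \<one>" using PE2 by blast
  obtain x where "\<zero> \<oplus> a = Some x" "x \<oplus> d = Some \<one>" using assoc_right[OF d e] by blast
  then show ?thesis using d one_left_unique by blast
qed

lemma le_iff_right: "a \<sqsubseteq> b \<longleftrightarrow> (\<exists>d. a \<oplus> d = Some b)"
  unfolding le_def using PE3 by blast

lemma rdiff_eqI: "x \<oplus> a = Some b \<Longrightarrow> rdiff b a = x"
  unfolding rdiff_def using right_cancel by blast

lemma ldiff_eqI: "a \<oplus> y = Some b \<Longrightarrow> ldiff a b = y"
  unfolding ldiff_def using left_cancel by blast

lemma rdiff_oplus: "a \<sqsubseteq> b \<Longrightarrow> rdiff b a \<oplus> a = Some b"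
  using rdiff_eqI le_def by auto

lemma oplus_ldiff: "a \<sqsubseteq> b \<Longrightarrow> a \<oplus> ldiff a b = Some b"
  using ldiff_eqI le_iff_right by auto

lemma lcompl_oplus: "lcompl a \<oplus> a = Some \<one>"
  unfolding lcompl_def using PE2 le_def rdiff_oplus by blast

lemma oplus_rcompl: "a \<oplus> rcompl a = Some \<one>"
  unfolding rcompl_def using PE2 le_iff_right oplus_ldiff by blast

sublocale order: order le less
proof
  fix x y z
  show "x \<sqsubset> y \<longleftrightarrow> x \<sqsubseteq> y \<and> \<not> y \<sqsubseteq> x" by (rule less_def)
  show "x \<sqsubseteq> x" using zero_oplus le_def by blast
  show "x \<sqsubseteq> y \<Longrightarrow> y \<sqsubseteq> z \<Longrightarrow> x \<sqsubseteq> z"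
    unfolding le_def by (meson assoc_right)
  assume "x \<sqsubseteq> y" "y \<sqsubseteq> x"
  then obtain c d where c: "c \<oplus> x = Some y" and d: "d \<oplus> y = Some x" unfolding le_def by blast
  obtain w where w: "d \<oplus> c = Some w" "w \<oplus> x = Some x" using assoc_right[OF c d] by blast
  then have "w = \<zero>" using right_cancel zero_oplus by blast
  then obtain v where "c \<oplus> \<one> = Some v" using assoc_left[OF _ zero_oplus] w by blast
  then have "c = \<zero>" using PE4 by blast
  then show "x = y" using c zero_oplus by auto
qed

lemma meet_eqI: "is_meet a b m \<Longrightarrow> a \<sqinter> b = m"
  unfolding meet_def by (rule the_equality) (auto simp: is_meet_def intro: order.order.antisym)

lemma join_eqI: "is_join a b j \<Longrightarrow> a \<squnion> b = j"
  unfolding join_def by (rule the_equality) (auto simp: is_join_def intro: order.order.antisym)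

end

locale lattice_pseudo_effect_algebra = pseudo_effect_algebra +
  assumes meet_ex: "\<exists>m. is_meet a b m"
    and join_ex: "\<exists>j. is_join a b j"
begin

lemma is_meet_meet: "is_meet a b (a \<sqinter> b)"
  using meet_ex meet_eqI by blast

lemma is_join_join: "is_join a b (a \<squnion> b)"
  using join_ex join_eqI by blast

sublocale lattice: lattice meet le less join
  by unfold_locales (use is_meet_meet is_join_join in \<open>auto simp: is_meet_def is_join_def\<close>)

definition sasaki_circ :: "'a \<Rightarrow> 'a \<Rightarrow> 'a"
  where "sasaki_circ x y = ldiff (x \<sqinter> lcompl y) x"

definition sasaki_star :: "'a \<Rightarrow> 'a \<Rightarrow> 'a"
  where "sasaki_star x y = rdiff x (x \<sqinter> rcompl y)"

definition compatible :: "'a \<Rightarrow> 'a \<Rightarrow> bool"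
  where "compatible a b \<longleftrightarrow>
    rdiff (a \<squnion> b) a = rdiff b (a \<sqinter> b) \<and> rdiff (a \<squnion> b) b = rdiff a (a \<sqinter> b)"

end

locale pseudo_MV_algebra = lattice_pseudo_effect_algebra +
  assumes all_compatible: "compatible a b"

end

theory Submission
  imports Defs
begin

text \<open>
  Left and right complement are mutually inverse order anti-automorphisms, so the left complement
  turns joins into meets; moreover it carries the right difference \<open>j \ e\<close> to a left difference
  of complements, \<open>j\<^sup>- / e\<^sup>-\<close>. Writing an arbitrary \<open>e\<close> as the right complement of \<open>e\<^sup>-\<close>, one gets
  \<open>a \<ast> e\<^sup>- = a \ (a \<sqinter> e)\<close> and \<open>e\<^sup>- \<circ> a = (e\<^sup>- \<sqinter> a\<^sup>-) / e\<^sup>- = (a \<squnion> e)\<^sup>- / e\<^sup>- = (a \<squnion> e) \ e\<close>.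
  The hypothesis at the pair \<open>(a, e\<^sup>-)\<close> is therefore one of the two equations in the definition of
  compatibility of \<open>a\<close> and \<open>e\<close>, and exchanging \<open>a\<close> and \<open>e\<close> gives the other one.
\<close>

context pseudo_effect_algebra
begin

lemma rcompl_lcompl: "rcompl (lcompl a) = a"
  unfolding rcompl_def using lcompl_oplus by (rule ldiff_eqI)

lemma lcompl_rcompl: "lcompl (rcompl a) = a"
  unfolding lcompl_def using oplus_rcompl by (rule rdiff_eqI)

text \<open>
  Substituting \<open>b = (b \ a) \<oplus> a\<close> into \<open>b\<^sup>- \<oplus> b = \<one>\<close> and reassociating leaves a left complement
  of \<open>a\<close>. Both antitonicity and the exchange of the two differences come from this identity.
\<close>

lemma lcompl_oplus_rdiff:
  assumes "a \<sqsubseteq> b"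
  shows "lcompl b \<oplus> rdiff b a = Some (lcompl a)"
proof -
  obtain x where x: "lcompl b \<oplus> rdiff b a = Some x" "x \<oplus> a = Some \<one>"
    using assoc_right[OF rdiff_oplus[OF assms] lcompl_oplus] by blast
  from x(2) have "lcompl a = x" unfolding lcompl_def by (rule rdiff_eqI)
  with x(1) show ?thesis by simp
qed

lemma ldiff_lcompl: "a \<sqsubseteq> b \<Longrightarrow> ldiff (lcompl b) (lcompl a) = rdiff b a"
  by (rule ldiff_eqI) (rule lcompl_oplus_rdiff)

lemma lcompl_antimono: "a \<sqsubseteq> b \<Longrightarrow> lcompl b \<sqsubseteq> lcompl a"
  unfolding le_iff_right[of "lcompl b"] using lcompl_oplus_rdiff by blast

lemma rcompl_antimono:
  assumes "a \<sqsubseteq> b"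
  shows "rcompl b \<sqsubseteq> rcompl a"
proof -
  obtain y where y: "ldiff a b \<oplus> rcompl b = Some y" "a \<oplus> y = Some \<one>"
    using assoc_left[OF oplus_ldiff[OF assms] oplus_rcompl] by blast
  from y(2) have "rcompl a = y" unfolding rcompl_def by (rule ldiff_eqI)
  with y(1) show ?thesis unfolding le_def by blast
qed

lemma le_lcompl_iff: "z \<sqsubseteq> lcompl a \<longleftrightarrow> a \<sqsubseteq> rcompl z"
  using rcompl_antimono[of z "lcompl a"] lcompl_antimono[of a "rcompl z"]
  by (auto simp: rcompl_lcompl lcompl_rcompl)

end

context lattice_pseudo_effect_algebra
begin

text \<open>By the Galois connection above, lower bounds of \<open>a\<^sup>-\<close> and \<open>b\<^sup>-\<close> correspond to upper bounds
  of \<open>a\<close> and \<open>b\<close>.\<close>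

lemma lcompl_join: "lcompl a \<sqinter> lcompl b = lcompl (a \<squnion> b)"
  by (rule meet_eqI) (simp add: is_meet_def le_lcompl_iff rcompl_lcompl)

lemma sasaki_star_lcompl: "sasaki_star a (lcompl b) = rdiff a (a \<sqinter> b)"
  by (simp add: sasaki_star_def rcompl_lcompl)

lemma sasaki_circ_lcompl: "sasaki_circ (lcompl b) a = rdiff (a \<squnion> b) b"
  by (simp add: sasaki_circ_def lcompl_join ldiff_lcompl lattice.sup.commute)

text \<open>Read at \<open>(a, b\<^sup>-)\<close>, the exchange law for the Sasaki operations is half of compatibility;
  the other half is its instance at \<open>(b, a\<^sup>-)\<close>.\<close>

lemma compatible_if_star_eq_circ:
  assumes "\<And>x y. sasaki_star x y = sasaki_circ y x"
  shows "compatible a b"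
proof -
  have half: "rdiff (x \<squnion> y) y = rdiff x (x \<sqinter> y)" for x y
    using assms[of x "lcompl y"] by (simp add: sasaki_star_lcompl sasaki_circ_lcompl)
  from half[of b a] half[of a b] show ?thesis
    by (simp add: compatible_def lattice.sup.commute lattice.inf.commute)
qed

end

theorem theorem4p7:
  fixes oplus :: "'a \<Rightarrow> 'a \<Rightarrow> 'a option" and zero one :: 'a
  assumes "lattice_pseudo_effect_algebra oplus zero one"
    and "\<And>a b. lattice_pseudo_effect_algebra.sasaki_star oplus one a b
           = lattice_pseudo_effect_algebra.sasaki_circ oplus one b a"
  shows "pseudo_MV_algebra oplus zero one"
proof -
  interpret lattice_pseudo_effect_algebra oplus zero one by (fact assms(1))
  show ?thesis
    by unfold_locales (rule compatible_if_star_eq_circ, rule assms(2))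
qed

end
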